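(* Let $N\ge 1$ and let $J\in\mathbb{R}^{N\times N}$ be a symmetric matrix with zero diagonal. Assume that the oscillator Ising machine with coupling matrix $J$ is frustration-free, i.e. there exists $\sigma\in\{-1,1\}^N$ such that $J_{ij}\sigma_i\sigma_j\ge 0$ for all $i,j$. For $\mu=(\mu_1,\dots,\mu_N)\in\mathbb{R}^N_{>0}$ consider the dynamical system on the torus $\mathbb{T}^N$ $$\dot\theta_i=\sum_{j=1}^N J_{ij}\sin(\theta_j-\theta_i)-\mu_i\sin(2\theta_i),\qquad i=1,\dots,N,$$ and for $\sigma\in\{-1,1\}^N$ let $\theta^*(\sigma)\in\mathbb{T}^N$ be its equilibrium given by $\theta^*_i(\sigma)=0$ if $\sigma_i=1$ and $\theta_i^*(\sigma)=\pi$ if $\sigma_i=-1$. Let $\mathcal{H}(\sigma)=-\frac12\sum_{i=1}^N\sum_{j=1}^N J_{ij}\sigma_i\sigma_j$. Then: (i) If $\sigma^*\in\{-1,1\}^N$ is a global minimizer of $\mathcal{H}$ over $\{-1,1\}^N$, then $\theta^*(\sigma^* )$ is an asymptotically stable equilibrium for every $\mu\in\mathbb{R}^N_{>0}$. (ii) There exists $\mu^*>0$ such that for all $\mu\in\mathbb{R}^N_{>0}$ with $0<\mu_i<\mu^*$ for all $i$, and for every $\sigma\in\{-1,1\}^N$ that is not a global minimizer of $\mathcal{H}$ over $\{-1,1\}^N$, the equilibrium $\theta^*(\sigma)$ is unstable.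
   Context: $\mathbb{T}^N=(\mathbb{R}/2\pi\mathbb{Z})^N$ is the $N$-torus and $\mathbb{R}^N_{>0}$ is the set of vectors with all entries positive. $J$ is the weighted adjacency matrix of an undirected graph on nodes $1,\dots,N$ without self-loops; edges are the pairs with $J_{ij}\neq 0$. For a spin configuration $\sigma\in\{-1,1\}^N$, the signed graph $G_{\rm s}(\sigma)$ has signed adjacency matrix $A_{ij}(\sigma)=J_{ij}\sigma_i\sigma_j$. The system is called frustrated if $G_{\rm s}(\sigma)$ has at least one negative edge for every $\sigma$, and frustration-free otherwise. Stability, asymptotic stability and instability of an equilibrium are meant in the usual (Lyapunov) sense for the ordinary differential equation $\dot\theta_i=\sum_{j=1}^N J_{ij}\sin(\theta_j-\theta_i)-\mu_i\sin(2\theta_i)$, $i=1,\dots,N$, on $\mathbb{T}^N$. *)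

theory Defs
  imports "HOL-Analysis.Analysis"
begin

definition angle_rel :: "real \<Rightarrow> real \<Rightarrow> bool" where
  "angle_rel x y \<longleftrightarrow> (\<exists>k::int. x - y = 2 * pi * of_int k)"

lemma angle_rel_add:
  assumes "angle_rel x x'" "angle_rel y y'"
  shows "angle_rel (x + y) (x' + y')"
proof -
  from assms obtain k l :: int where "x - x' = 2 * pi * of_int k" "y - y' = 2 * pi * of_int l"
    unfolding angle_rel_def by blast
  then have "(x + y) - (x' + y') = 2 * pi * of_int (k + l)"
    by (simp add: algebra_simps)
  then show ?thesis unfolding angle_rel_def by blast
qed

lemma angle_rel_minus:
  assumes "angle_rel x x'"
  shows "angle_rel (- x) (- x')"
proof -
  from assms obtain k :: int where "x - x' = 2 * pi * of_int k"
    unfolding angle_rel_def by blast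
  then have "(- x) - (- x') = 2 * pi * of_int (- k)"
    by (simp add: algebra_simps)
  then show ?thesis unfolding angle_rel_def by blast
qed

lemma equivp_angle_rel: "equivp angle_rel"
proof (rule equivpI)
  show "reflp angle_rel"
    by (rule reflpI) (auto simp: angle_rel_def intro: exI[of _ 0])
  show "symp angle_rel"
  proof (rule sympI)
    fix x y assume "angle_rel x y"
    then obtain k :: int where "x - y = 2 * pi * of_int k"
      unfolding angle_rel_def by blast
    then have "y - x = 2 * pi * of_int (- k)" by simp
    then show "angle_rel y x" unfolding angle_rel_def by blast
  qed
  show "transp angle_rel"
  proof (rule transpI)
    fix x y z assume "angle_rel x y" "angle_rel y z"
    then obtain k l :: int where "x - y = 2 * pi * of_int k" "y - z = 2 * pi * of_int l"
      unfolding angle_rel_def by blast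
    then have "x - z = 2 * pi * of_int (k + l)" by (simp add: algebra_simps)
    then show "angle_rel x z" unfolding angle_rel_def by blast
  qed
qed

quotient_type angle = real / angle_rel
  morphisms rep_angle angle_of
  by (rule equivp_angle_rel)

lemma angle_of_eq_iff: "angle_of x = angle_of y \<longleftrightarrow> (\<exists>k::int. x - y = 2 * pi * of_int k)"
  by (simp add: angle.abs_eq_iff angle_rel_def)

lemma angle_of_surj: "\<exists>x. a = angle_of x"
  by (metis Quotient_abs_rep[OF Quotient_angle])

instantiation angle :: ab_group_add
begin

lift_definition zero_angle :: angle is "0 :: real" .

lift_definition plus_angle :: "angle \<Rightarrow> angle \<Rightarrow> angle" is "(+)"
  by (rule angle_rel_add)

lift_definition uminus_angle :: "angle \<Rightarrow> angle" is "uminus"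
  by (rule angle_rel_minus)

definition minus_angle :: "angle \<Rightarrow> angle \<Rightarrow> angle" where
  "minus_angle a b = a + (- b)"

instance
proof
  fix a b c :: angle
  show "a + b + c = a + (b + c)"
    by transfer (simp add: add.assoc equivp_reflp[OF equivp_angle_rel])
  show "a + b = b + a"
    by transfer (simp add: add.commute equivp_reflp[OF equivp_angle_rel])
  show "0 + a = a"
    by transfer (simp add: equivp_reflp[OF equivp_angle_rel])
  show "- a + a = 0"
    by transfer (simp add: equivp_reflp[OF equivp_angle_rel])
  show "a - b = a + - b"
    by (simp add: minus_angle_def)
qed

end

lift_definition sin_angle :: "angle \<Rightarrow> real" is sin
proof -
  fix x y assume "angle_rel x y"
  then obtain k :: int where k: "x - y = 2 * pi * of_int k"
    unfolding angle_rel_def by blast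
  have "sin x = sin (y + 2 * pi * of_int k)"
    using k by (simp add: algebra_simps)
  also have "\<dots> = sin y"
    by (simp add: sin_add sin_int_2pin cos_int_2pin)
  finally show "sin x = sin y" .
qed

instantiation angle :: metric_space
begin

definition dist_angle :: "angle \<Rightarrow> angle \<Rightarrow> real" where
  "dist_angle a b = Inf {\<bar>x - y\<bar> | x y. angle_of x = a \<and> angle_of y = b}"

definition uniformity_angle :: "(angle \<times> angle) filter" where
  "uniformity_angle = (INF e\<in>{0<..}. principal {(a, b). dist a b < e})"

definition open_angle :: "angle set \<Rightarrow> bool" where
  "open_angle U \<longleftrightarrow> (\<forall>a\<in>U. \<forall>\<^sub>F (a', b) in uniformity. a' = a \<longrightarrow> b \<in> U)"

instance
proof
  let ?D = "\<lambda>a b. {\<bar>x - y\<bar> | x y. angle_of x = a \<and> angle_of y = b}"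
  have ne: "?D a b \<noteq> {}" for a b
    using angle_of_surj[of a] angle_of_surj[of b] by blast
  have bdd: "bdd_below (?D a b)" for a b
    by (rule bdd_belowI[of _ 0]) auto
  have le: "dist (angle_of x) (angle_of y) \<le> \<bar>x - y\<bar>" for x y
    unfolding dist_angle_def by (rule cInf_lower[OF _ bdd]) blast
  have approx: "\<exists>x y. angle_of x = a \<and> angle_of y = b \<and> \<bar>x - y\<bar> < e"
    if "dist a b < e" for a b e
    using cInf_lessD[OF ne, of a b e] that unfolding dist_angle_def by blast
  have nonneg: "0 \<le> dist a b" for a b :: angle
    unfolding dist_angle_def by (rule cInf_greatest[OF ne]) auto
  have refl: "dist a a = 0" for a :: angle
    using le nonneg[of a a] angle_of_surj[of a] by (metis abs_zero antisym diff_self)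
  have sym: "dist a b \<le> dist b a" for a b :: angle
  proof (rule field_le_epsilon)
    fix e :: real assume "0 < e"
    then obtain x y where "angle_of x = b" "angle_of y = a" "\<bar>x - y\<bar> < dist b a + e"
      using approx[of b a "dist b a + e"] by auto
    then show "dist a b \<le> dist b a + e"
      using le[of y x] by (simp add: abs_minus_commute)
  qed
  have tri: "dist a c \<le> dist a b + dist b c" for a b c :: angle
  proof (rule field_le_epsilon)
    fix e :: real assume "0 < e"
    then obtain x y where xy: "angle_of x = a" "angle_of y = b" "\<bar>x - y\<bar> < dist a b + e / 2"
      using approx[of a b "dist a b + e / 2"] by auto
    obtain y' z where yz: "angle_of y' = b" "angle_of z = c" "\<bar>y' - z\<bar> < dist b c + e / 2"
      using approx[of b c "dist b c + e / 2"] \<open>0 < e\<close> by auto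
    obtain k :: int where k: "y - y' = 2 * pi * of_int k"
      using xy(2) yz(1) angle_of_eq_iff by metis
    have "angle_of (z + (y - y')) = c"
      unfolding yz(2)[symmetric] angle_of_eq_iff using k by auto
    then have "dist a c \<le> \<bar>x - (z + (y - y'))\<bar>"
      using le[of x "z + (y - y')"] xy(1) by simp
    also have "\<dots> \<le> \<bar>x - y\<bar> + \<bar>y' - z\<bar>" by linarith
    finally show "dist a c \<le> dist a b + dist b c + e"
      using xy(3) yz(3) by linarith
  qed
  have pos: "a = b" if "dist a b = 0" for a b :: angle
  proof -
    obtain u v where uv: "a = angle_of u" "b = angle_of v"
      using angle_of_surj by metis
    show ?thesis
    proof (rule ccontr)
      assume neq: "a \<noteq> b"
      define d where "d = (u - v) / (2 * pi)"
      define e where "e = min (frac d) (1 - frac d)"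
      have d: "u - v = 2 * pi * d" by (simp add: d_def)
      have "frac d \<noteq> 0"
        using neq uv d angle_of_eq_iff[of u v] by (metis Ints_cases frac_eq_0_iff)
      then have "0 < e"
        using frac_ge_0[of d] frac_lt_1[of d] unfolding e_def by linarith
      then obtain x y where xy: "angle_of x = a" "angle_of y = b" "\<bar>x - y\<bar> < 2 * pi * e"
        using approx[of a b "2 * pi * e"] \<open>dist a b = 0\<close> by auto
      obtain k l :: int where "x - u = 2 * pi * of_int k" "y - v = 2 * pi * of_int l"
        using xy uv angle_of_eq_iff by metis
      then have "x - y = 2 * pi * (d + of_int (k - l))"
        using d by (simp add: algebra_simps)
      then have "2 * pi * \<bar>d + of_int (k - l)\<bar> < 2 * pi * e"
        using xy(3) by (simp add: abs_mult)
      then have lt: "\<bar>d + of_int (k - l)\<bar> < e"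
        by simp
      define m where "m = \<lfloor>d\<rfloor> + (k - l)"
      have eq: "d + of_int (k - l) = frac d + of_int m"
        by (simp add: m_def frac_def)
      show False
      proof (cases "m \<ge> 0")
        case True
        then have "(0::real) \<le> of_int m" by simp
        then show False
          using lt eq frac_ge_0[of d] unfolding e_def by linarith
      next
        case False
        then have "of_int m \<le> (-1::real)" by linarith
        then show False
          using lt eq frac_lt_1[of d] unfolding e_def by linarith
      qed
    qed
  qed
  show "dist a b = 0 \<longleftrightarrow> a = b" for a b :: angle
    using pos refl by metis
  show "dist a b \<le> dist a c + dist b c" for a b c :: angle
    using tri[of a b c] sym[of c b] by (meson add_left_mono order_trans)
  show "uniformity = (INF e\<in>{0<..}. principal {(a, b :: angle). dist a b < e})"
    by (rule uniformity_angle_def)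
  show "open U \<longleftrightarrow> (\<forall>a\<in>U. \<forall>\<^sub>F (a', b) in uniformity. a' = a \<longrightarrow> b \<in> U)" for U :: "angle set"
    by (rule open_angle_def)
qed

end

type_synonym 'n torus = "(angle, 'n) vec"

text \<open>The tangent bundle of the torus is trivial, so a vector field is a map into
  \<^typ>\<open>(real, 'n) vec\<close>. The velocity of a curve on the torus is that of a lift to the
  universal cover; every continuous curve has such a lift.\<close>

definition torus_of :: "real ^ 'n \<Rightarrow> 'n::finite torus" where
  "torus_of \<theta> = (\<chi> i. angle_of (\<theta> $ i))"

definition solves_torus_ode :: "(real \<Rightarrow> 'n::finite torus) \<Rightarrow> ('n torus \<Rightarrow> real ^ 'n) \<Rightarrow> bool" where
  "solves_torus_ode x F \<longleftrightarrow>
     (\<exists>\<theta> :: real \<Rightarrow> real ^ 'n. \<forall>t\<ge>0. x t = torus_of (\<theta> t) \<and>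
        (\<theta> has_vector_derivative F (x t)) (at t within {0..}))"

definition equilibrium :: "('n::finite torus \<Rightarrow> real ^ 'n) \<Rightarrow> 'n torus \<Rightarrow> bool" where
  "equilibrium F p \<longleftrightarrow> F p = 0"

text \<open>Quantifying over solutions defined for all nonnegative times loses nothing for a smooth
  vector field, since the torus is compact.\<close>

definition lyapunov_stable :: "('n::finite torus \<Rightarrow> real ^ 'n) \<Rightarrow> 'n torus \<Rightarrow> bool" where
  "lyapunov_stable F p \<longleftrightarrow> equilibrium F p \<and>
     (\<forall>\<epsilon>>0. \<exists>\<delta>>0. \<forall>x. solves_torus_ode x F \<and> dist (x 0) p < \<delta> \<longrightarrow>
        (\<forall>t\<ge>0. dist (x t) p < \<epsilon>))"

definition asymptotically_stable :: "('n::finite torus \<Rightarrow> real ^ 'n) \<Rightarrow> 'n torus \<Rightarrow> bool" where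
  "asymptotically_stable F p \<longleftrightarrow> lyapunov_stable F p \<and>
     (\<exists>\<delta>>0. \<forall>x. solves_torus_ode x F \<and> dist (x 0) p < \<delta> \<longrightarrow> (x \<longlongrightarrow> p) at_top)"

definition unstable :: "('n::finite torus \<Rightarrow> real ^ 'n) \<Rightarrow> 'n torus \<Rightarrow> bool" where
  "unstable F p \<longleftrightarrow> equilibrium F p \<and> \<not> lyapunov_stable F p"

definition spins :: "(real ^ 'n::finite) set" where
  "spins = {\<sigma>. \<forall>i. \<sigma> $ i \<in> {-1, 1}}"

definition signed_adjacency :: "real ^ 'n ^ 'n \<Rightarrow> real ^ 'n \<Rightarrow> real ^ 'n ^ 'n::finite" where
  "signed_adjacency J \<sigma> = (\<chi> i j. J $ i $ j * \<sigma> $ i * \<sigma> $ j)"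

definition frustrated :: "real ^ 'n ^ 'n::finite \<Rightarrow> bool" where
  "frustrated J \<longleftrightarrow> (\<forall>\<sigma>\<in>spins. \<exists>i j. signed_adjacency J \<sigma> $ i $ j < 0)"

abbreviation frustration_free :: "real ^ 'n ^ 'n::finite \<Rightarrow> bool" where
  "frustration_free J \<equiv> \<not> frustrated J"

lemma frustration_free_iff:
  "frustration_free J \<longleftrightarrow> (\<exists>\<sigma>\<in>spins. \<forall>i j. J $ i $ j * \<sigma> $ i * \<sigma> $ j \<ge> 0)"
  by (simp add: frustrated_def signed_adjacency_def not_less)

definition ising_energy :: "real ^ 'n ^ 'n \<Rightarrow> real ^ 'n::finite \<Rightarrow> real" where
  "ising_energy J \<sigma> = - (1 / 2) * (\<Sum>i\<in>UNIV. \<Sum>j\<in>UNIV. J $ i $ j * \<sigma> $ i * \<sigma> $ j)"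

definition oim_field :: "real ^ 'n ^ 'n \<Rightarrow> real ^ 'n \<Rightarrow> 'n::finite torus \<Rightarrow> real ^ 'n" where
  "oim_field J \<mu> \<theta> = (\<chi> i. (\<Sum>j\<in>UNIV. J $ i $ j * sin_angle (\<theta> $ j - \<theta> $ i))
                         - \<mu> $ i * sin_angle (\<theta> $ i + \<theta> $ i))"

definition spin_equilibrium :: "real ^ 'n \<Rightarrow> 'n::finite torus" where
  "spin_equilibrium \<sigma> = (\<chi> i. if \<sigma> $ i = 1 then angle_of 0 else angle_of pi)"

end

theory Submission
  imports Defs
begin

text \<open>
  Around \<open>\<theta>*(\<sigma>)\<close> the system is the same oscillator network with couplings
  \<open>A\<^sub>i\<^sub>j = J\<^sub>i\<^sub>j \<sigma>\<^sub>i \<sigma>\<^sub>j\<close>, and its linearization \<open>M\<close> at the equilibrium is symmetric with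
  \<open>x \<bullet> M x = - 1/2 \<Sum> A\<^sub>i\<^sub>j (x\<^sub>i - x\<^sub>j)\<^sup>2 - 2 \<Sum> \<mu>\<^sub>i x\<^sub>i\<^sup>2\<close>. Without frustration, \<open>\<sigma>\<close> is a ground state
  iff \<open>A \<ge> 0\<close>, and then \<open>M\<close> is negative definite. Otherwise let \<open>\<tau>\<close> be a ground state and
  \<open>s\<^sub>i = \<sigma>\<^sub>i \<tau>\<^sub>i\<close>: the edges with \<open>s\<^sub>i \<noteq> s\<^sub>j\<close> are exactly the ones with \<open>A\<^sub>i\<^sub>j < 0\<close>, so \<open>s \<bullet> M s > 0\<close> for
  small \<open>\<mu>\<close>. Instability follows from the quadratic function \<open>V x = x \<bullet> (M x - c x)\<close>, where
  \<open>c > 0\<close> is not an eigenvalue of \<open>M\<close> and \<open>V s > 0\<close>: since \<open>M - c\<close> is bounded below, \<open>V' \<ge> 2 c V\<close>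
  holds on a whole neighbourhood of the equilibrium, even if \<open>M\<close> is singular.
\<close>

subsection \<open>Lifting from the torus to the universal cover\<close>

lemma dist_angle_of_le: "dist (angle_of x) (angle_of y) \<le> \<bar>x - y\<bar>"
  unfolding dist_angle_def by (rule cInf_lower) (auto intro!: bdd_belowI[of _ 0])

text \<open>Other representatives change \<open>x - y\<close> by a multiple of
  \<open>2 * pi\<close>; a nonzero multiple leaves an absolute value of at least
  \<open>2 * pi - pi\<close>. So the projection to the circle preserves distances up to half a
  turn.\<close>

lemma dist_angle_of_eq:
  assumes "\<bar>x - y\<bar> \<le> pi"
  shows "dist (angle_of x) (angle_of y) = \<bar>x - y\<bar>"
proof (rule antisym[OF dist_angle_of_le])
  show "\<bar>x - y\<bar> \<le> dist (angle_of x) (angle_of y)"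
    unfolding dist_angle_def
  proof (rule cInf_greatest)
    fix d assume "d \<in> {\<bar>x' - y'\<bar> |x' y'. angle_of x' = angle_of x \<and> angle_of y' = angle_of y}"
    then obtain x' y' k l where d: "d = \<bar>x' - y'\<bar>"
      and "x' - x = 2 * pi * of_int k" "y' - y = 2 * pi * of_int l"
      unfolding angle_of_eq_iff by blast
    then have eq: "x' - y' = (x - y) + 2 * pi * of_int (k - l)"
      by (simp add: algebra_simps)
    show "\<bar>x - y\<bar> \<le> d"
    proof (cases "k = l")
      case False
      then have "1 \<le> \<bar>k - l\<bar>" by linarith
      then have "1 \<le> \<bar>real_of_int (k - l)\<bar>" by linarith
      then have "2 * pi * 1 \<le> 2 * pi * \<bar>real_of_int (k - l)\<bar>"
        by (intro mult_left_mono) auto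
      also have "\<dots> = \<bar>2 * pi * of_int (k - l)\<bar>" by (simp add: abs_mult)
      finally show ?thesis using assms d eq by linarith
    qed (use d eq in simp)
  qed blast
qed

text \<open>Rounding the offset from \<open>y\<close>, measured in full turns, to the nearest
  integer leaves an error of at most half a turn.\<close>

lemma angle_of_near: "\<exists>x. angle_of x = a \<and> \<bar>x - y\<bar> \<le> pi"
proof -
  obtain u where u: "a = angle_of u" using angle_of_surj by blast
  define d where "d = (u - y) / (2 * pi)"
  then have d: "u - y = 2 * pi * d" by simp
  have "\<bar>of_int (round d) - d\<bar> \<le> 1 / 2" by (rule of_int_round_abs_le)
  then have "2 * pi * \<bar>of_int (round d) - d\<bar> \<le> 2 * pi * (1 / 2)"
    by (intro mult_left_mono) auto
  moreover have "\<bar>u - 2 * pi * of_int (round d) - y\<bar> = 2 * pi * \<bar>of_int (round d) - d\<bar>"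
  proof -
    have "u - 2 * pi * of_int (round d) - y = - (2 * pi * (of_int (round d) - d))"
      using d by (simp add: right_diff_distrib)
    then show ?thesis by (simp add: abs_mult)
  qed
  moreover have "angle_of (u - 2 * pi * of_int (round d)) = a"
    unfolding u angle_of_eq_iff by (rule exI[of _ "- round d"]) simp
  ultimately show ?thesis by (intro exI[of _ "u - 2 * pi * of_int (round d)"]) simp
qed

lemma dist_torus_of_le: "dist (torus_of x) (torus_of y) \<le> norm (x - y)"
  unfolding dist_vec_def norm_vec_def torus_of_def
  by (rule L2_set_mono) (auto simp: dist_angle_of_le)

lemma dist_torus_of_eq:
  assumes "\<And>i. \<bar>x $ i - y $ i\<bar> \<le> pi"
  shows "dist (torus_of x) (torus_of y) = norm (x - y)"
  unfolding dist_vec_def norm_vec_def torus_of_def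
  by (rule L2_set_cong) (auto simp: dist_angle_of_eq assms)

lemma torus_of_near:
  fixes q :: "'n::finite torus"
  shows "\<exists>x. torus_of x = q \<and> norm (x - y) = dist q (torus_of y)"
proof -
  have "\<forall>i. \<exists>x. angle_of x = q $ i \<and> \<bar>x - y $ i\<bar> \<le> pi"
    using angle_of_near by blast
  then obtain x where x: "\<And>i. angle_of (x i) = q $ i" "\<And>i. \<bar>x i - y $ i\<bar> \<le> pi"
    by metis
  then have "torus_of (\<chi> i. x i) = q" by (simp add: torus_of_def vec_eq_iff)
  moreover have "dist (torus_of (\<chi> i. x i)) (torus_of y) = norm ((\<chi> i. x i) - y)"
    by (rule dist_torus_of_eq) (simp add: x)
  ultimately show ?thesis by metis
qed

text \<open>Two lifts of one point differ by a deck transformation, which can be subtracted from a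
  whole lifted curve. This moves the lift of a solution to a chosen starting point.\<close>

lemma torus_of_shift:
  assumes "torus_of a = torus_of b"
  shows "torus_of (c - (a - b)) = torus_of c"
proof -
  have "angle_of (c $ i - (a $ i - b $ i)) = angle_of (c $ i)" for i
  proof -
    have "angle_of (a $ i) = angle_of (b $ i)"
      using assms by (simp add: torus_of_def vec_eq_iff)
    then obtain k :: int where "a $ i - b $ i = 2 * pi * of_int k"
      unfolding angle_of_eq_iff by blast
    then show ?thesis unfolding angle_of_eq_iff by (intro exI[of _ "- k"]) simp
  qed
  then show ?thesis by (simp add: torus_of_def)
qed

text \<open>A lift cannot drift to another sheet unnoticed: to leave the ball it must pass through
  norm exactly \<open>\<epsilon>\<close>, where torus distance and norm agree because
  \<open>\<epsilon> \<le> pi\<close>.\<close>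

lemma norm_lift_less:
  fixes z :: "real \<Rightarrow> real ^ 'n::finite"
  assumes cont: "continuous_on {0..} z" and "norm (z 0) < \<epsilon>" and "\<epsilon> \<le> pi"
    and close: "\<And>t. t \<ge> 0 \<Longrightarrow> dist (torus_of (p + z t)) (torus_of p) < \<epsilon>"
    and "t \<ge> 0"
  shows "norm (z t) < \<epsilon>"
proof (rule ccontr)
  assume "\<not> norm (z t) < \<epsilon>"
  moreover have "continuous_on {0..t} (\<lambda>t. norm (z t))"
    by (intro continuous_intros continuous_on_subset[OF cont]) auto
  ultimately obtain s where s: "0 \<le> s" "norm (z s) = \<epsilon>"
    using IVT'[of "\<lambda>t. norm (z t)" 0 \<epsilon> t] assms by auto
  have "\<bar>z s $ i\<bar> \<le> pi" for i
    using component_le_norm_cart[of "z s" i] s assms by linarith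
  then have "dist (torus_of (p + z s)) (torus_of p) = norm (z s)"
    using dist_torus_of_eq[of "p + z s" p] by simp
  then show False using close[of s] s by simp
qed

subsection \<open>Stability by linearization\<close>

text \<open>The function \<open>u t * exp (- k * t)\<close> is nondecreasing. The inequality is
  asked only for \<open>t < T\<close>, so that the lemma still applies at a first exit time.\<close>

lemma gronwall_lower:
  fixes u u' :: "real \<Rightarrow> real"
  assumes "0 \<le> T"
    and deriv: "\<And>t. 0 \<le> t \<Longrightarrow> t \<le> T \<Longrightarrow> (u has_real_derivative u' t) (at t within {0..T})"
    and le: "\<And>t. 0 \<le> t \<Longrightarrow> t < T \<Longrightarrow> k * u t \<le> u' t"
  shows "u 0 * exp (k * T) \<le> u T"
proof (cases "T = 0")
  case False
  then have "0 < T" using assms by simp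
  define w where "w = (\<lambda>t. u t * exp (- k * t))"
  have "(w has_derivative (*) ((u' t - k * u t) * exp (- k * t))) (at t within {0..T})"
    if "0 \<le> t" "t \<le> T" for t
    unfolding w_def has_field_derivative_def[symmetric]
    by (rule derivative_eq_intros deriv[OF that] refl | simp add: algebra_simps)+
  from mvt_simple[OF \<open>0 < T\<close> this]
  obtain t where t: "t \<in> {0<..<T}"
    and "w T - w 0 = (u' t - k * u t) * exp (- k * t) * (T - 0)"
    by blast
  moreover have "0 \<le> (u' t - k * u t) * exp (- k * t) * (T - 0)"
    using le[of t] t by (intro mult_nonneg_nonneg) auto
  ultimately have "u 0 \<le> u T * exp (- (k * T))" by (simp add: w_def)
  then have "u 0 * exp (k * T) \<le> u T * exp (- (k * T)) * exp (k * T)"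
    by (intro mult_right_mono) auto
  then show ?thesis by (simp add: mult.assoc flip: exp_add)
qed simp

lemma norm_square_has_real_derivative:
  fixes z :: "real \<Rightarrow> 'a::real_inner"
  assumes "(z has_vector_derivative z') (at t within S)"
  shows "((\<lambda>t. z t \<bullet> z t) has_real_derivative 2 * (z t \<bullet> z')) (at t within S)"
  unfolding has_real_derivative_iff_has_vector_derivative
  by (rule has_vector_derivative_eq_rhs
      [OF bounded_bilinear.has_vector_derivative[OF bounded_bilinear_inner assms assms]])
    (simp add: inner_commute)

lemma has_derivative_at_zero_remainder:
  assumes "(f has_derivative M) (at 0)" "f 0 = 0" "e > 0"
  obtains r where "r > 0" "\<And>x. norm x < r \<Longrightarrow> norm (f x - M x) \<le> e * norm x"
  using assms unfolding has_derivative_at_alt by (metis diff_zero)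

text \<open>Near the origin the nonlinear remainder uses up at most half of the margin
  \<open>2 * c\<close>, so the squared norm decays at rate \<open>2 * c\<close> as long as the
  solution stays there. A first-exit argument shows that it always does.\<close>

lemma linear_stable_decay:
  fixes f :: "'a::euclidean_space \<Rightarrow> 'a"
  assumes deriv: "(f has_derivative M) (at 0)" and "f 0 = 0"
    and "c > 0" and neg: "\<And>x. x \<bullet> M x \<le> - 2 * c * (x \<bullet> x)"
  shows "\<exists>r>0. \<forall>z. (\<forall>t\<ge>0. (z has_vector_derivative f (z t)) (at t within {0..})) \<and> norm (z 0) < r
           \<longrightarrow> (\<forall>t\<ge>0. norm (z t) \<le> norm (z 0) * exp (- c * t))"
proof -
  obtain r where "r > 0" and r: "\<And>x. norm x < r \<Longrightarrow> norm (f x - M x) \<le> c * norm x"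
    using has_derivative_at_zero_remainder[OF deriv \<open>f 0 = 0\<close> \<open>c > 0\<close>] by blast
  have inner_le: "x \<bullet> f x \<le> - c * (x \<bullet> x)" if "norm x < r" for x
  proof -
    have "x \<bullet> (f x - M x) \<le> norm x * norm (f x - M x)" by (rule norm_cauchy_schwarz)
    also have "\<dots> \<le> norm x * (c * norm x)" by (intro mult_left_mono r that) auto
    also have "\<dots> = c * (x \<bullet> x)" by (simp add: dot_square_norm power2_eq_square)
    finally show ?thesis using neg[of x] by (simp add: inner_diff_right algebra_simps)
  qed
  have "norm (z t) \<le> norm (z 0) * exp (- c * t)"
    if z: "\<And>t. t \<ge> 0 \<Longrightarrow> (z has_vector_derivative f (z t)) (at t within {0..})"
      and z0: "norm (z 0) < r" and "t \<ge> 0" for z t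
  proof -
    have decay: "norm (z T) \<le> norm (z 0) * exp (- c * T)"
      if "T \<ge> 0" and small: "\<And>t. 0 \<le> t \<Longrightarrow> t < T \<Longrightarrow> norm (z t) < r" for T
    proof -
      \<comment> \<open>The minus sign turns the lower Gronwall bound, used with the rate
        \<open>- 2 * c\<close>, into an upper bound on the norm.\<close>
      define u where "u = (\<lambda>t. - (z t \<bullet> z t))"
      have "(u has_real_derivative - (2 * (z t \<bullet> f (z t)))) (at t within {0..T})"
        if "0 \<le> t" "t \<le> T" for t
        unfolding u_def
        by (intro DERIV_minus norm_square_has_real_derivative has_vector_derivative_within_subset[OF z])
          (use that in auto)
      moreover have "- 2 * c * u t \<le> - (2 * (z t \<bullet> f (z t)))" if "0 \<le> t" "t < T" for t
        using inner_le[OF small[OF that]] by (simp add: u_def)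
      ultimately have "u 0 * exp (- 2 * c * T) \<le> u T"
        by (rule gronwall_lower[OF \<open>T \<ge> 0\<close>])
      then have "(norm (z T))\<^sup>2 \<le> (norm (z 0))\<^sup>2 * exp (- 2 * c * T)"
        by (simp add: u_def dot_square_norm)
      also have "\<dots> = (norm (z 0) * exp (- c * T))\<^sup>2"
        by (simp add: power_mult_distrib exp_double[symmetric] mult.assoc)
      finally show ?thesis by (rule power2_le_imp_le) auto
    qed
    have "norm (z t) < r" if "t \<ge> 0" for t
    proof (rule ccontr)
      assume nl: "\<not> norm (z t) < r"
      have "continuous_on {0..} z"
        by (rule continuous_on_vector_derivative[OF z]) simp
      then have cont: "continuous_on {0..t} (\<lambda>t. norm (z t))"
        by (intro continuous_on_norm) (rule continuous_on_subset, auto)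
      \<comment> \<open>\<open>Inf E\<close> is the first exit time. The decay estimate holds up to
        and including it and gives a norm below \<open>r\<close> there, a contradiction.\<close>
      define E where "E = {s\<in>{0..t}. r \<le> norm (z s)}"
      have "closed E"
        unfolding E_def by (intro continuous_on_closed_Collect_le cont) auto
      moreover have "E \<noteq> {}" "bdd_below E"
        using nl that by (auto simp: E_def not_less intro!: bdd_belowI[of _ 0])
      ultimately have T: "Inf E \<in> E" by (intro closed_contains_Inf)
      have "norm (z s) < r" if "0 \<le> s" "s < Inf E" for s
      proof (rule ccontr)
        assume "\<not> norm (z s) < r"
        then have "s \<in> E" using that T by (auto simp: E_def)
        then show False using cInf_lower[OF _ \<open>bdd_below E\<close>] that by force
      qed
      then have "norm (z (Inf E)) \<le> norm (z 0) * exp (- c * Inf E)"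
        using decay[of "Inf E"] T by (auto simp: E_def)
      also have "\<dots> \<le> norm (z 0)"
        using T \<open>c > 0\<close> by (intro mult_left_le) (auto simp: E_def)
      finally show False using T z0 by (auto simp: E_def)
    qed
    then show ?thesis using decay \<open>t \<ge> 0\<close> by simp
  qed
  then show ?thesis using \<open>r > 0\<close> by blast
qed

section \<open>Instability from a positive direction of a self-adjoint linearization\<close>

text \<open>Eigenvectors for distinct eigenvalues are orthogonal, hence independent, so there are
  only finitely many eigenvalues, and an open interval contains other points.\<close>

lemma self_adjoint_noneigenvalue:
  fixes M :: "'a::euclidean_space \<Rightarrow> 'a"
  assumes "linear M" and sym: "\<And>x y. M x \<bullet> y = x \<bullet> M y" and "a < (b::real)"
  obtains c where "a < c" "c < b" "inj (\<lambda>x. M x - c *\<^sub>R x)"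
proof -
  define E where "E = {c. \<exists>x. x \<noteq> 0 \<and> M x = c *\<^sub>R x}"
  define e where "e = (\<lambda>c. SOME x. x \<noteq> 0 \<and> M x = c *\<^sub>R x)"
  have e: "e c \<noteq> 0" "M (e c) = c *\<^sub>R e c" if "c \<in> E" for c
    using someI_ex[of "\<lambda>x. x \<noteq> 0 \<and> M x = c *\<^sub>R x"] that unfolding E_def e_def by auto
  have orth: "e c \<bullet> e d = 0" if "c \<in> E" "d \<in> E" "c \<noteq> d" for c d
    using sym[of "e c" "e d"] e that by simp
  have inj: "inj_on e E"
  proof (rule inj_onI)
    fix c d assume "c \<in> E" "d \<in> E" "e c = e d"
    then show "c = d" using orth[of c d] e(1)[of d] by auto
  qed
  have "independent (e ` E)"
  proof (rule pairwise_orthogonal_independent)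
    show "pairwise orthogonal (e ` E)"
      using orth unfolding pairwise_def orthogonal_def by blast
    show "0 \<notin> e ` E"
      using e(1) by (metis imageE)
  qed
  then have "finite E"
    using inj finite_imageD independent_imp_finite by blast
  then have "infinite ({a<..<b} - E)"
    using \<open>a < b\<close> by (simp add: infinite_Ioo)
  then obtain c where c: "c \<in> {a<..<b}" "c \<notin> E"
    by (metis DiffD1 DiffD2 ex_in_conv finite.emptyI)
  have "linear (\<lambda>x. M x - c *\<^sub>R x)"
    by (intro linear_compose_sub \<open>linear M\<close> linear_scale_self)
  then have "inj (\<lambda>x. M x - c *\<^sub>R x)"
    using c(2) by (auto simp: linear_injective_0 E_def)
  then show ?thesis using that c by auto
qed

text \<open>A Chetaev argument: the quadratic form of \<open>P = M - c\<close> is bounded on a ball,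
  yet it grows exponentially along any solution that starts on the line through \<open>v\<close>,
  off the origin, and stays in the ball.\<close>

lemma linear_unstable_escape:
  fixes f :: "'a::euclidean_space \<Rightarrow> 'a"
  assumes deriv: "(f has_derivative M) (at 0)" and "f 0 = 0"
    and sym: "\<And>x y. M x \<bullet> y = x \<bullet> M y" and pos: "v \<bullet> M v > 0"
  obtains r where "r > 0"
    and "\<And>a z. a \<noteq> 0 \<Longrightarrow> z 0 = a *\<^sub>R v \<Longrightarrow>
      (\<And>t. t \<ge> 0 \<Longrightarrow> (z has_vector_derivative f (z t)) (at t within {0..})) \<Longrightarrow>
      \<exists>t\<ge>0. norm (z t) \<ge> r"
proof -
  have bl: "bounded_linear M" using deriv by (rule has_derivative_bounded_linear)
  then have lin: "linear M" by (rule bounded_linear.linear)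
  have "M 0 = 0" using lin by (rule linear_0)
  then have "v \<noteq> 0" using pos by auto
  then have "0 < (v \<bullet> M v) / (v \<bullet> v)" using pos by simp
  \<comment> \<open>Lying below the Rayleigh quotient of \<open>v\<close> keeps the form of
    \<open>P\<close> positive at \<open>v\<close>; injectivity bounds \<open>P\<close> from below,
    which lets it absorb the remainder.\<close>
  then obtain c where "0 < c" "c < (v \<bullet> M v) / (v \<bullet> v)" and inj: "inj (\<lambda>x. M x - c *\<^sub>R x)"
    using self_adjoint_noneigenvalue[OF lin sym] by blast
  define P where "P = (\<lambda>x. M x - c *\<^sub>R x)"
  have blP: "bounded_linear P"
    unfolding P_def by (intro bounded_linear_sub bl bounded_linear_scaleR_right)
  then have linP: "linear P" by (rule bounded_linear.linear)
  have symP: "P x \<bullet> y = x \<bullet> P y" for x y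
    using sym by (simp add: P_def inner_diff_left inner_diff_right)
  have posP: "v \<bullet> P v > 0"
    using \<open>c < _\<close> \<open>v \<noteq> 0\<close> by (simp add: P_def inner_diff_right field_simps)
  obtain m where "m > 0" and m: "\<And>x. m * norm x \<le> norm (P x)"
    using linear_inj_bounded_below_pos[OF linP] inj unfolding P_def by blast
  obtain r where "r > 0" and r: "\<And>x. norm x < r \<Longrightarrow> norm (f x - M x) \<le> m * norm x"
    using has_derivative_at_zero_remainder[OF deriv \<open>f 0 = 0\<close> \<open>m > 0\<close>] by blast
  \<comment> \<open>With \<open>R = f - M\<close> one has \<open>P x \<bullet> f x = |P x|\<^sup>2 + c (x \<bullet> P x) + P x \<bullet> R x\<close>, and \<open>|R x| \<le> |P x|\<close>.\<close>
  have growth: "c * (x \<bullet> P x) \<le> P x \<bullet> f x" if "norm x < r" for x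
  proof -
    have "\<bar>P x \<bullet> (f x - M x)\<bar> \<le> norm (P x) * norm (f x - M x)"
      by (rule Cauchy_Schwarz_ineq2)
    also have "\<dots> \<le> norm (P x) * norm (P x)"
      using r[OF that] m[of x] by (intro mult_left_mono) auto
    also have "\<dots> = P x \<bullet> P x" by (simp add: dot_square_norm power2_eq_square)
    finally have "0 \<le> P x \<bullet> P x + P x \<bullet> (f x - M x)" by linarith
    also have "P x + (f x - M x) = f x - c *\<^sub>R x" by (simp add: P_def)
    then have "P x \<bullet> P x + P x \<bullet> (f x - M x) = P x \<bullet> f x - c * (x \<bullet> P x)"
      by (metis inner_add_right inner_commute inner_diff_right inner_scaleR_right)
    finally show ?thesis by simp
  qed
  obtain K where K: "\<And>x. norm (P x) \<le> norm x * K"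
    using bounded_linear.bounded[OF blP] by blast
  have "\<exists>t\<ge>0. norm (z t) \<ge> r"
    if "a \<noteq> 0" "z 0 = a *\<^sub>R v"
      and z: "\<And>t. t \<ge> 0 \<Longrightarrow> (z has_vector_derivative f (z t)) (at t within {0..})" for a z
  proof (rule ccontr)
    assume "\<not> ?thesis"
    then have small: "norm (z t) < r" if "t \<ge> 0" for t using that by force
    define u where "u = (\<lambda>t. z t \<bullet> P (z t))"
    have "u 0 = a\<^sup>2 * (v \<bullet> P v)"
      by (simp add: u_def that linear_scale[OF linP] power2_eq_square)
    then have "u 0 > 0" using posP \<open>a \<noteq> 0\<close> by simp
    have lower: "u 0 * exp (2 * c * T) \<le> u T" if "T \<ge> 0" for T
    proof (rule gronwall_lower[OF that, where u' = "\<lambda>t. 2 * (P (z t) \<bullet> f (z t))"])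
      fix t assume t: "0 \<le> t" "t \<le> T"
      have zt: "(z has_vector_derivative f (z t)) (at t within {0..T})"
        by (rule has_vector_derivative_within_subset[OF z]) (use t in auto)
      show "(u has_real_derivative 2 * (P (z t) \<bullet> f (z t))) (at t within {0..T})"
        unfolding u_def has_real_derivative_iff_has_vector_derivative
        by (rule has_vector_derivative_eq_rhs
            [OF bounded_bilinear.has_vector_derivative[OF bounded_bilinear_inner zt
                bounded_linear.has_vector_derivative[OF blP zt]]])
          (simp add: inner_commute symP[symmetric])
    next
      fix t assume "0 \<le> t" "t < T"
      then show "2 * c * u t \<le> 2 * (P (z t) \<bullet> f (z t))"
        using growth[OF small[of t]] by (simp add: u_def)
    qed
    have upper: "u T \<le> r * (r * \<bar>K\<bar>)" if "T \<ge> 0" for T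
    proof -
      have "u T \<le> norm (z T) * norm (P (z T))"
        unfolding u_def by (rule norm_cauchy_schwarz)
      also have "\<dots> \<le> r * (r * \<bar>K\<bar>)"
      proof (intro mult_mono)
        have "norm (P (z T)) \<le> norm (z T) * \<bar>K\<bar>"
          using K[of "z T"] by (meson abs_ge_self mult_left_mono norm_ge_zero order_trans)
        also have "\<dots> \<le> r * \<bar>K\<bar>"
          using small[OF that] by (intro mult_right_mono) auto
        finally show "norm (P (z T)) \<le> r * \<bar>K\<bar>" .
      qed (use small[OF that] \<open>r > 0\<close> in auto)
      finally show ?thesis .
    qed
    \<comment> \<open>At this time \<open>u 0 * (2 * c * T)\<close> equals the upper bound on
      \<open>u\<close>, and the exponential exceeds its linear part.\<close>
    define T where "T = r * (r * \<bar>K\<bar>) / (u 0 * (2 * c))"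
    have "T \<ge> 0" using \<open>r > 0\<close> \<open>u 0 > 0\<close> \<open>c > 0\<close> by (simp add: T_def)
    have "r * (r * \<bar>K\<bar>) = u 0 * (2 * c * T)"
      using \<open>u 0 > 0\<close> \<open>c > 0\<close> by (simp add: T_def)
    also have "\<dots> < u 0 * exp (2 * c * T)"
      using \<open>u 0 > 0\<close> exp_ge_add_one_self[of "2 * c * T"] by (intro mult_strict_left_mono) linarith+
    finally show False using lower[OF \<open>T \<ge> 0\<close>] upper[OF \<open>T \<ge> 0\<close>] by linarith
  qed
  then show ?thesis using that \<open>r > 0\<close> by blast
qed

subsection \<open>Global solutions for Lipschitz vector fields\<close>

lemma integral_has_vector_derivative_atLeast:
  fixes g :: "real \<Rightarrow> 'a::banach"
  assumes "continuous_on {a..} g" "a \<le> t"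
  shows "((\<lambda>u. integral {a..u} g) has_vector_derivative g t) (at t within {a..})"
proof -
  have "continuous_on {a..t + 1} g"
    by (rule continuous_on_subset[OF assms(1)]) auto
  then have "((\<lambda>u. integral {a..u} g) has_vector_derivative g t) (at t within {a..t + 1})"
    by (rule integral_has_vector_derivative) (use assms in auto)
  moreover have "at t within {a..t + 1} = at t within {a..}"
    by (rule at_within_nhd[of t "{..<t + 1}"]) auto
  ultimately show ?thesis by simp
qed

text \<open>Integrating \<open>C * exp (k * s)\<close> gives at most
  \<open>C / k * exp (k * u)\<close>, and the weight cancels the exponential. The factor
  \<open>1 / k\<close> is what makes the Picard map contract.\<close>

lemma weighted_integral_bound:
  fixes g :: "real \<Rightarrow> 'a::banach"
  assumes "0 \<le> u" "0 < k" "0 \<le> C" and cont: "continuous_on {0..u} g"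
    and le: "\<And>s. s \<in> {0..u} \<Longrightarrow> norm (g s) \<le> C * exp (k * s)"
  shows "exp (- k * u) * norm (integral {0..u} g) \<le> C / k"
proof -
  have "((\<lambda>s. C * exp (k * s)) has_integral (C / k * exp (k * u) - C / k * exp (k * 0))) {0..u}"
  proof (rule fundamental_theorem_of_calculus[OF \<open>0 \<le> u\<close>])
    fix s
    show "((\<lambda>s. C / k * exp (k * s)) has_vector_derivative C * exp (k * s)) (at s within {0..u})"
      unfolding has_real_derivative_iff_has_vector_derivative[symmetric]
      by (rule derivative_eq_intros refl | use \<open>0 < k\<close> in simp)+
  qed
  then have int: "((\<lambda>s. C * exp (k * s)) has_integral (C / k * (exp (k * u) - 1))) {0..u}"
    by (simp add: right_diff_distrib)
  then have "norm (integral {0..u} g) \<le> C / k * (exp (k * u) - 1)"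
    using integral_norm_bound_integral[OF integrable_continuous_real[OF cont] _ le] integral_unique[OF int]
    by (metis has_integral_integrable)
  also have "\<dots> \<le> C / k * exp (k * u)"
    using assms by (intro mult_left_mono) auto
  finally have "exp (- k * u) * norm (integral {0..u} g) \<le> exp (- k * u) * (C / k * exp (k * u))"
    by (intro mult_left_mono) auto
  then show ?thesis by (simp add: exp_minus field_simps)
qed

text \<open>Stability quantifies over solutions on the whole half-line, so refuting it requires such
  a solution to exist.\<close>

lemma lipschitz_ode_global_solution:
  fixes f :: "'a::banach \<Rightarrow> 'a"
  assumes "L-lipschitz_on UNIV f"
  obtains z where "z 0 = x0"
    and "\<And>t. t \<ge> 0 \<Longrightarrow> (z has_vector_derivative f (z t)) (at t within {0..})"
proof -
  \<comment> \<open>\<open>L\<close> may be zero; a strictly positive constant allows division by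
    \<open>k\<close> below.\<close>
  define l where "l = L + 1"
  have "l > 0" using lipschitz_on_nonneg[OF assms] by (simp add: l_def)
  have lip: "norm (f x - f y) \<le> l * norm (x - y)" for x y
  proof -
    have "norm (f x - f y) \<le> L * norm (x - y)"
      using lipschitz_onD[OF assms, of x y] by (simp add: dist_norm)
    also have "\<dots> \<le> l * norm (x - y)" by (intro mult_right_mono) (auto simp: l_def)
    finally show ?thesis .
  qed
  have contf: "continuous_on UNIV f" by (rule lipschitz_on_continuous_on[OF assms])
  \<comment> \<open>The contraction factor will be \<open>l / k = 1 / 2\<close>.\<close>
  define k where "k = 2 * l"
  have "k > 0" using \<open>l > 0\<close> by (simp add: k_def)
  \<comment> \<open>The unknown is \<open>y t = exp (- k t) z t\<close>: the weight makes the Picard map a contraction in the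
    supremum norm on the whole half-line.\<close>
  define h where "h = (\<lambda>y :: real \<Rightarrow>\<^sub>C 'a. \<lambda>s. f (exp (k * s) *\<^sub>R apply_bcontfun y s))"
  have conth: "continuous_on S (h y)" for y S
    unfolding h_def by (rule continuous_on_compose2[OF contf]) (auto intro!: continuous_intros)
  define I where "I = (\<lambda>y u. integral {0..u} (h y))"
  have derivI: "(I y has_vector_derivative h y t) (at t within {0..})" if "t \<ge> 0" for y t
    unfolding I_def by (rule integral_has_vector_derivative_atLeast[OF conth that])
  \<comment> \<open>Bounded continuous functions live on the whole line here; \<open>max 0 t\<close>
    extends the weighted Picard map by the constant \<open>x0\<close> to negative times.\<close>
  define \<Phi> where "\<Phi> = (\<lambda>y t. exp (- k * max 0 t) *\<^sub>R (x0 + I y (max 0 t)))"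
  have "\<Phi> y \<in> bcontfun" for y
  proof -
    have "continuous_on {0..} (I y)"
      by (rule continuous_on_vector_derivative[OF derivI]) simp
    then have "continuous_on UNIV (\<lambda>t::real. I y (max 0 t))"
      by (rule continuous_on_compose2) (auto intro!: continuous_intros)
    then have "continuous_on UNIV (\<Phi> y)"
      unfolding \<Phi>_def by (intro continuous_intros)
    moreover have "bounded (range (\<Phi> y))"
    proof -
      obtain B where B: "\<And>s. norm (apply_bcontfun y s) \<le> B"
        using bounded_apply_bcontfun[of y] unfolding bounded_iff by auto
      have "0 \<le> B" using B[of 0] norm_ge_zero order_trans by blast
      define C where "C = norm (f 0) + l * B"
      have "0 \<le> C" using \<open>0 \<le> B\<close> \<open>l > 0\<close> by (simp add: C_def)
      have hle: "norm (h y s) \<le> C * exp (k * s)" if "s \<ge> 0" for s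
      proof -
        have "norm (h y s) \<le> norm (f 0) + norm (f (exp (k * s) *\<^sub>R apply_bcontfun y s) - f 0)"
          unfolding h_def by (metis add.commute norm_triangle_sub)
        also have "\<dots> \<le> norm (f 0) * exp (k * s) + l * (exp (k * s) * B)"
        proof (rule add_mono)
          show "norm (f 0) \<le> norm (f 0) * exp (k * s)"
            using \<open>k > 0\<close> that mult_left_mono[of 1 "exp (k * s)" "norm (f 0)"] by simp
          have "norm (f (exp (k * s) *\<^sub>R apply_bcontfun y s) - f 0)
            \<le> l * norm (exp (k * s) *\<^sub>R apply_bcontfun y s - 0)" by (rule lip)
          also have "\<dots> \<le> l * (exp (k * s) * B)"
            using B \<open>l > 0\<close> by (auto intro!: mult_left_mono)
          finally show "norm (f (exp (k * s) *\<^sub>R apply_bcontfun y s) - f 0) \<le> l * (exp (k * s) * B)" .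
        qed
        also have "\<dots> = C * exp (k * s)" by (simp add: C_def algebra_simps)
        finally show ?thesis .
      qed
      have "norm (\<Phi> y t) \<le> norm x0 + C / k" for t
      proof -
        define u where "u = max 0 t"
        have "u \<ge> 0" by (simp add: u_def)
        have "norm (\<Phi> y t) = exp (- k * u) * norm (x0 + I y u)"
          by (simp add: \<Phi>_def u_def)
        also have "\<dots> \<le> exp (- k * u) * (norm x0 + norm (I y u))"
          by (intro mult_left_mono norm_triangle_ineq) auto
        also have "\<dots> = exp (- k * u) * norm x0 + exp (- k * u) * norm (I y u)"
          by (simp add: distrib_left)
        also have "\<dots> \<le> norm x0 + C / k"
        proof (rule add_mono)
          show "exp (- k * u) * norm x0 \<le> norm x0"
            using \<open>k > 0\<close> \<open>u \<ge> 0\<close> by (intro mult_left_le_one_le) auto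
          show "exp (- k * u) * norm (I y u) \<le> C / k"
            unfolding I_def
            by (rule weighted_integral_bound[OF \<open>u \<ge> 0\<close> \<open>k > 0\<close> \<open>0 \<le> C\<close> conth]) (auto intro: hle)
        qed
        finally show ?thesis .
      qed
      then show ?thesis unfolding bounded_iff by blast
    qed
    ultimately show ?thesis by (simp add: bcontfun_def)
  qed
  then have app: "apply_bcontfun (Bcontfun (\<Phi> y)) = \<Phi> y" for y
    by (simp add: Bcontfun_inverse)
  have "dist (Bcontfun (\<Phi> x)) (Bcontfun (\<Phi> y)) \<le> 1 / 2 * dist x y" for x y
  proof (rule dist_bound)
    fix t :: real
    define u where "u = max 0 t"
    have "u \<ge> 0" by (simp add: u_def)
    have le: "norm (h x s - h y s) \<le> (l * dist x y) * exp (k * s)" for s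
    proof -
      have "norm (h x s - h y s)
        \<le> l * norm (exp (k * s) *\<^sub>R apply_bcontfun x s - exp (k * s) *\<^sub>R apply_bcontfun y s)"
        unfolding h_def by (rule lip)
      also have "\<dots> = l * (exp (k * s) * dist (apply_bcontfun x s) (apply_bcontfun y s))"
        by (simp add: dist_norm flip: scaleR_diff_right)
      also have "\<dots> \<le> l * (exp (k * s) * dist x y)"
        using \<open>l > 0\<close> by (intro mult_left_mono dist_bounded) auto
      finally show ?thesis by (simp add: algebra_simps)
    qed
    have "dist (\<Phi> x t) (\<Phi> y t) = exp (- k * u) * norm (I x u - I y u)"
      by (simp add: \<Phi>_def dist_norm u_def flip: scaleR_diff_right)
    also have "I x u - I y u = integral {0..u} (\<lambda>s. h x s - h y s)"
      unfolding I_def by (intro integral_diff[symmetric] integrable_continuous_real conth)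
    also have "exp (- k * u) * norm (integral {0..u} (\<lambda>s. h x s - h y s)) \<le> l * dist x y / k"
      by (rule weighted_integral_bound[OF \<open>u \<ge> 0\<close> \<open>k > 0\<close>])
        (use le \<open>l > 0\<close> in \<open>auto intro!: continuous_on_diff conth\<close>)
    also have "\<dots> = 1 / 2 * dist x y" using \<open>l > 0\<close> by (simp add: k_def)
    finally show "dist (apply_bcontfun (Bcontfun (\<Phi> x)) t) (apply_bcontfun (Bcontfun (\<Phi> y)) t)
      \<le> 1 / 2 * dist x y"
      by (simp add: app)
  qed
  then obtain y where "Bcontfun (\<Phi> y) = y"
    using banach_fix_type[of "1 / 2" "\<lambda>y. Bcontfun (\<Phi> y)"] by auto
  then have y: "apply_bcontfun y = \<Phi> y" using app by metis
  define z where "z = (\<lambda>t. x0 + I y t)"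
  \<comment> \<open>At the fixed point, undoing the weight in \<open>y t\<close> gives exactly
    \<open>x0 + I y t\<close>.\<close>
  have "h y t = f (z t)" if "t \<ge> 0" for t
    using that by (simp add: h_def y \<Phi>_def z_def flip: exp_add)
  then have "(z has_vector_derivative f (z t)) (at t within {0..})" if "t \<ge> 0" for t
    using has_vector_derivative_add[OF has_vector_derivative_const derivI[OF that, of y]] that
    by (simp add: z_def)
  moreover have "z 0 = x0" by (simp add: z_def I_def)
  ultimately show ?thesis using that by blast
qed

subsection \<open>Equilibria on the torus\<close>

text \<open>Decay of a well-placed lift passes to the torus because the projection does not increase
  distances.\<close>

lemma asymptotically_stable_by_linearization:
  fixes f :: "real ^ 'n::finite \<Rightarrow> real ^ 'n"
  assumes lift: "\<And>z. F (torus_of (p + z)) = f z"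
    and deriv: "(f has_derivative M) (at 0)" and "f 0 = 0"
    and "c > 0" and neg: "\<And>x. x \<bullet> M x \<le> - 2 * c * (x \<bullet> x)"
  shows "asymptotically_stable F (torus_of p)"
proof -
  obtain r where "r > 0" and r: "\<And>z t. (\<And>t. t \<ge> 0 \<Longrightarrow> (z has_vector_derivative f (z t)) (at t within {0..}))
      \<Longrightarrow> norm (z 0) < r \<Longrightarrow> t \<ge> 0 \<Longrightarrow> norm (z t) \<le> norm (z 0) * exp (- c * t)"
    using linear_stable_decay[OF deriv \<open>f 0 = 0\<close> \<open>c > 0\<close> neg] by blast
  have decay: "dist (x t) (torus_of p) \<le> dist (x 0) (torus_of p) * exp (- c * t)"
    if "solves_torus_ode x F" "dist (x 0) (torus_of p) < r" "t \<ge> 0" for x t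
  proof -
    obtain \<theta> where "\<forall>t\<ge>0. x t = torus_of (\<theta> t) \<and> (\<theta> has_vector_derivative F (x t)) (at t within {0..})"
      using \<open>solves_torus_ode x F\<close> unfolding solves_torus_ode_def by blast
    then have x: "x t = torus_of (\<theta> t)"
      and \<theta>: "(\<theta> has_vector_derivative F (x t)) (at t within {0..})" if "t \<ge> 0" for t
      using that by auto
    obtain a where a: "torus_of a = x 0" "norm (a - p) = dist (x 0) (torus_of p)"
      using torus_of_near by blast
    \<comment> \<open>The given lift may start on a far sheet; it is translated to start at
      \<open>a\<close>, the lift of \<open>x 0\<close> whose distance from \<open>p\<close> is the
      torus distance.\<close>
    define z where "z = (\<lambda>t. \<theta> t - (\<theta> 0 - a) - p)"
    have xz: "x t = torus_of (p + z t)" if "t \<ge> 0" for t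
      using torus_of_shift[of "\<theta> 0" a "\<theta> t"] a x[of 0] x[OF that]
      by (simp add: z_def algebra_simps)
    have "(z has_vector_derivative f (z t)) (at t within {0..})" if "t \<ge> 0" for t
      using \<theta>[OF that] xz[OF that] lift[of "z t"] unfolding z_def
      by (auto intro!: derivative_eq_intros)
    moreover have "norm (z 0) = dist (x 0) (torus_of p)" using a by (simp add: z_def)
    ultimately have "norm (z t) \<le> dist (x 0) (torus_of p) * exp (- c * t)"
      using r[of z t] that by simp
    then show ?thesis
      using dist_torus_of_le[of "p + z t" p] xz[OF \<open>t \<ge> 0\<close>] by simp
  qed
  have "equilibrium F (torus_of p)"
    using lift[of 0] \<open>f 0 = 0\<close> by (simp add: equilibrium_def)
  moreover have "\<exists>\<delta>>0. \<forall>x. solves_torus_ode x F \<and> dist (x 0) (torus_of p) < \<delta> \<longrightarrow>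
      (\<forall>t\<ge>0. dist (x t) (torus_of p) < \<epsilon>)" if "\<epsilon> > 0" for \<epsilon>
  proof (intro exI[of _ "min r \<epsilon>"] conjI allI impI)
    fix x and t :: real
    assume x: "solves_torus_ode x F \<and> dist (x 0) (torus_of p) < min r \<epsilon>" and "t \<ge> 0"
    then have "dist (x t) (torus_of p) \<le> dist (x 0) (torus_of p) * exp (- c * t)"
      using decay by auto
    also have "\<dots> \<le> dist (x 0) (torus_of p)"
      using \<open>c > 0\<close> \<open>t \<ge> 0\<close> by (intro mult_left_le) auto
    finally show "dist (x t) (torus_of p) < \<epsilon>" using x by linarith
  qed (use \<open>r > 0\<close> that in auto)
  moreover have "(x \<longlongrightarrow> torus_of p) at_top"
    if "solves_torus_ode x F" "dist (x 0) (torus_of p) < r" for x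
  proof -
    have "((\<lambda>t. dist (x 0) (torus_of p) * exp (- c * t)) \<longlongrightarrow> 0) at_top"
      using \<open>c > 0\<close>
      by (intro tendsto_mult_right_zero filterlim_compose[OF exp_at_bot])
        (auto simp: filterlim_uminus_at_bot intro!: filterlim_tendsto_pos_mult_at_top filterlim_ident)
    then have "((\<lambda>t. dist (x t) (torus_of p)) \<longlongrightarrow> 0) at_top"
    proof (rule tendsto_sandwich[rotated 3])
      show "((\<lambda>_. 0) \<longlongrightarrow> (0::real)) at_top" by (rule tendsto_const)
      show "\<forall>\<^sub>F t in at_top. dist (x t) (torus_of p) \<le> dist (x 0) (torus_of p) * exp (- c * t)"
        using decay[OF that] by (rule eventually_at_top_linorderI)
    qed simp
    then show ?thesis by (rule iffD2[OF tendsto_dist_iff])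
  qed
  ultimately show ?thesis
    using \<open>r > 0\<close> unfolding asymptotically_stable_def lyapunov_stable_def by blast
qed

text \<open>Solutions starting at small multiples of \<open>v\<close> leave a fixed ball in the
  cover, while stability would confine their projections and hence their lifts.\<close>

lemma unstable_by_linearization:
  fixes f :: "real ^ 'n::finite \<Rightarrow> real ^ 'n"
  assumes lift: "\<And>z. F (torus_of (p + z)) = f z"
    and deriv: "(f has_derivative M) (at 0)" and "f 0 = 0" and lip: "L-lipschitz_on UNIV f"
    and sym: "\<And>x y. M x \<bullet> y = x \<bullet> M y" and pos: "v \<bullet> M v > 0"
  shows "unstable F (torus_of p)"
proof -
  obtain r where "r > 0" and r: "\<And>a z. a \<noteq> 0 \<Longrightarrow> z 0 = a *\<^sub>R v \<Longrightarrow>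
      (\<And>t. t \<ge> 0 \<Longrightarrow> (z has_vector_derivative f (z t)) (at t within {0..})) \<Longrightarrow>
      \<exists>t\<ge>0. norm (z t) \<ge> r"
    using linear_unstable_escape[OF deriv \<open>f 0 = 0\<close> sym pos] by blast
  have False if "lyapunov_stable F (torus_of p)"
  proof -
    \<comment> \<open>The cap \<open>pi\<close> lets closeness on the torus control the norm of the
      lift.\<close>
    define \<epsilon> where "\<epsilon> = min r pi"
    have "\<epsilon> > 0" using \<open>r > 0\<close> by (simp add: \<epsilon>_def)
    then obtain \<delta> where "\<delta> > 0" and \<delta>: "\<And>x t. solves_torus_ode x F \<Longrightarrow> dist (x 0) (torus_of p) < \<delta> \<Longrightarrow>
        t \<ge> 0 \<Longrightarrow> dist (x t) (torus_of p) < \<epsilon>"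
      using \<open>lyapunov_stable F (torus_of p)\<close> unfolding lyapunov_stable_def by blast
    define a where "a = min \<delta> \<epsilon> / (norm v + 1)"
    have "a > 0" using \<open>\<delta> > 0\<close> \<open>\<epsilon> > 0\<close> by (simp add: a_def add_nonneg_pos)
    have "a * norm v < a * (norm v + 1)" using \<open>a > 0\<close> by simp
    also have "\<dots> = min \<delta> \<epsilon>"
      using norm_ge_zero[of v] by (simp add: a_def add_nonneg_eq_0_iff)
    finally have small: "norm (a *\<^sub>R v) < min \<delta> \<epsilon>" using \<open>a > 0\<close> by simp
    obtain z where z0: "z 0 = a *\<^sub>R v"
      and z: "\<And>t. t \<ge> 0 \<Longrightarrow> (z has_vector_derivative f (z t)) (at t within {0..})"
      using lipschitz_ode_global_solution[OF lip] by blast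
    define x where "x = (\<lambda>t. torus_of (p + z t))"
    have "((\<lambda>t. p + z t) has_vector_derivative F (x t)) (at t within {0..})" if "t \<ge> 0" for t
      unfolding x_def lift using z[OF that] by (auto intro!: derivative_eq_intros)
    then have "solves_torus_ode x F"
      unfolding solves_torus_ode_def by (intro exI[of _ "\<lambda>t. p + z t"]) (simp add: x_def)
    moreover have "dist (x 0) (torus_of p) < \<delta>"
      using dist_torus_of_le[of "p + z 0" p] small by (simp add: x_def z0)
    ultimately have close: "dist (torus_of (p + z t)) (torus_of p) < \<epsilon>" if "t \<ge> 0" for t
      using \<delta> that unfolding x_def by blast
    have "continuous_on {0..} z"
      by (rule continuous_on_vector_derivative[OF z]) simp
    then have "norm (z t) < \<epsilon>" if "t \<ge> 0" for t
      by (rule norm_lift_less[OF _ _ _ close that]) (use small z0 in \<open>auto simp: \<epsilon>_def\<close>)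
    moreover obtain t where "t \<ge> 0" "norm (z t) \<ge> r" using r[of a z] \<open>a > 0\<close> z0 z by auto
    ultimately show False unfolding \<epsilon>_def by force
  qed
  then show ?thesis
    using lift[of 0] \<open>f 0 = 0\<close> by (auto simp: unstable_def equilibrium_def)
qed

subsection \<open>Oscillator Ising machines\<close>

text \<open>The vector field in coordinates on the cover centred at a spin equilibrium;
  \<open>A\<close> will be the signed adjacency matrix.\<close>

definition oim_lift :: "real ^ 'n ^ 'n \<Rightarrow> real ^ 'n \<Rightarrow> real ^ 'n \<Rightarrow> real ^ 'n::finite" where
  "oim_lift A \<mu> z = (\<chi> i. (\<Sum>j\<in>UNIV. A $ i $ j * sin (z $ j - z $ i)) - \<mu> $ i * sin (2 * z $ i))"

definition oim_linear :: "real ^ 'n ^ 'n \<Rightarrow> real ^ 'n \<Rightarrow> real ^ 'n \<Rightarrow> real ^ 'n::finite" where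
  "oim_linear A \<mu> h = (\<chi> i. (\<Sum>j\<in>UNIV. A $ i $ j * (h $ j - h $ i)) - \<mu> $ i * (2 * h $ i))"

definition spin_angle :: "real ^ 'n \<Rightarrow> real ^ 'n::finite" where
  "spin_angle \<sigma> = (\<chi> i. if \<sigma> $ i = 1 then 0 else pi)"

lemma spin_equilibrium_eq: "spin_equilibrium \<sigma> = torus_of (spin_angle \<sigma>)"
  by (simp add: spin_equilibrium_def torus_of_def spin_angle_def vec_eq_iff)

lemma spins_cases: "\<sigma> \<in> spins \<Longrightarrow> \<sigma> $ i = 1 \<or> \<sigma> $ i = -1"
  by (auto simp: spins_def)

lemma angle_of_add: "angle_of x + angle_of y = angle_of (x + y)"
  by (rule plus_angle.abs_eq)

lemma angle_of_diff: "angle_of x - angle_of y = angle_of (x - y)"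
  by (simp add: minus_angle_def plus_angle.abs_eq uminus_angle.abs_eq)

text \<open>Shifts by \<open>0\<close> or \<open>pi\<close> multiply the sine of a phase difference
  by the product of the two spins, and change doubled angles only by full turns.\<close>

lemma oim_field_spin_shift:
  assumes "\<sigma> \<in> spins"
  shows "oim_field J \<mu> (torus_of (spin_angle \<sigma> + z)) = oim_lift (signed_adjacency J \<sigma>) \<mu> z"
proof -
  have "sin (spin_angle \<sigma> $ j + z $ j - (spin_angle \<sigma> $ i + z $ i)) = \<sigma> $ i * \<sigma> $ j * sin (z $ j - z $ i)"
    for i j
    using spins_cases[OF assms, of i] spins_cases[OF assms, of j]
    by (auto simp: spin_angle_def sin_diff sin_add cos_add)
  moreover have "sin (spin_angle \<sigma> $ i + z $ i + (spin_angle \<sigma> $ i + z $ i)) = sin (2 * z $ i)" for i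
    using spins_cases[OF assms, of i]
    by (auto simp: spin_angle_def sin_add cos_add sin_double)
  ultimately show ?thesis
    by (simp add: oim_field_def oim_lift_def torus_of_def angle_of_add angle_of_diff sin_angle.abs_eq
        signed_adjacency_def vec_eq_iff mult.assoc)
qed

lemma oim_lift_zero: "oim_lift A \<mu> 0 = 0"
  by (simp add: oim_lift_def vec_eq_iff)

lemma oim_lift_has_derivative:
  fixes A :: "real ^ 'n::finite ^ 'n"
  shows "(oim_lift A \<mu> has_derivative oim_linear A \<mu>) (at 0)"
proof (subst has_derivative_componentwise_within, intro ballI)
  fix b :: "real ^ 'n" assume "b \<in> Basis"
  then obtain i where b: "b = axis i 1" by (auto simp: Basis_vec_def)
  have nth: "((\<lambda>z. z $ j) has_derivative (\<lambda>h. h $ j)) (at (0 :: real ^ 'n))" for j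
    by (rule bounded_linear.has_derivative[OF bounded_linear_vec_nth has_derivative_ident])
  have "((\<lambda>z. (\<Sum>j\<in>UNIV. A $ i $ j * sin (z $ j - z $ i)) - \<mu> $ i * sin (2 * z $ i)) has_derivative
      (\<lambda>h. (\<Sum>j\<in>UNIV. A $ i $ j * (h $ j - h $ i)) - \<mu> $ i * (2 * h $ i))) (at 0)"
    by (rule derivative_eq_intros nth refl | simp)+
  then show "((\<lambda>z. oim_lift A \<mu> z \<bullet> b) has_derivative (\<lambda>h. oim_linear A \<mu> h \<bullet> b)) (at 0)"
    by (simp add: b inner_axis oim_lift_def oim_linear_def)
qed

lemma abs_sin_diff_le: "\<bar>sin x - sin y\<bar> \<le> \<bar>x - y :: real\<bar>"
proof -
  have "\<bar>sin x - sin y\<bar> = 2 * \<bar>sin ((x - y) / 2)\<bar> * \<bar>cos ((x + y) / 2)\<bar>"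
    by (simp add: sin_diff_sin abs_mult)
  also have "\<dots> \<le> 2 * \<bar>(x - y) / 2\<bar> * 1"
    by (intro mult_mono abs_sin_x_le_abs_x) auto
  finally show ?thesis by simp
qed

lemma oim_lift_lipschitz: "\<exists>L. L-lipschitz_on UNIV (oim_lift A \<mu>)"
proof -
  \<comment> \<open>Every sine occurring in the field is 2-Lipschitz in the state; the components
    are summed through the l1 norm.\<close>
  define L where "L = (\<Sum>i\<in>UNIV. (\<Sum>j\<in>UNIV. \<bar>A $ i $ j\<bar> * 2) + \<bar>\<mu> $ i\<bar> * 2)"
  have "dist (oim_lift A \<mu> x) (oim_lift A \<mu> y) \<le> L * dist x y" for x y
  proof -
    let ?d = "norm (x - y)"
    have comp: "\<bar>x $ i - y $ i\<bar> \<le> ?d" for i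
      using component_le_norm_cart[of "x - y" i] by simp
    have A: "\<bar>A $ i $ j * sin (x $ j - x $ i) - A $ i $ j * sin (y $ j - y $ i)\<bar> \<le> \<bar>A $ i $ j\<bar> * 2 * ?d" for i j
    proof -
      have "\<bar>sin (x $ j - x $ i) - sin (y $ j - y $ i)\<bar> \<le> \<bar>(x $ j - x $ i) - (y $ j - y $ i)\<bar>"
        by (rule abs_sin_diff_le)
      also have "\<dots> \<le> 2 * ?d" using comp[of i] comp[of j] by linarith
      finally have "\<bar>A $ i $ j\<bar> * \<bar>sin (x $ j - x $ i) - sin (y $ j - y $ i)\<bar> \<le> \<bar>A $ i $ j\<bar> * (2 * ?d)"
        by (rule mult_left_mono) simp
      then show ?thesis by (simp add: abs_mult flip: right_diff_distrib)
    qed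
    have \<mu>: "\<bar>\<mu> $ i * sin (2 * x $ i) - \<mu> $ i * sin (2 * y $ i)\<bar> \<le> \<bar>\<mu> $ i\<bar> * 2 * ?d" for i
    proof -
      have "\<bar>sin (2 * x $ i) - sin (2 * y $ i)\<bar> \<le> \<bar>2 * x $ i - 2 * y $ i\<bar>"
        by (rule abs_sin_diff_le)
      also have "\<dots> \<le> 2 * ?d" using comp[of i] by linarith
      finally have "\<bar>\<mu> $ i\<bar> * \<bar>sin (2 * x $ i) - sin (2 * y $ i)\<bar> \<le> \<bar>\<mu> $ i\<bar> * (2 * ?d)"
        by (rule mult_left_mono) simp
      then show ?thesis by (simp add: abs_mult flip: right_diff_distrib)
    qed
    have "norm (oim_lift A \<mu> x - oim_lift A \<mu> y) \<le> (\<Sum>i\<in>UNIV. \<bar>(oim_lift A \<mu> x - oim_lift A \<mu> y) $ i\<bar>)"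
      by (rule norm_le_l1_cart)
    also have "\<dots> \<le> (\<Sum>i\<in>UNIV. ((\<Sum>j\<in>UNIV. \<bar>A $ i $ j\<bar> * 2) + \<bar>\<mu> $ i\<bar> * 2) * ?d)"
    proof (rule sum_mono)
      fix i
      have "\<bar>(\<Sum>j\<in>UNIV. A $ i $ j * sin (x $ j - x $ i) - A $ i $ j * sin (y $ j - y $ i))\<bar>
        \<le> (\<Sum>j\<in>UNIV. \<bar>A $ i $ j\<bar> * 2 * ?d)"
        by (rule order_trans[OF sum_abs sum_mono]) (rule A)
      then show "\<bar>(oim_lift A \<mu> x - oim_lift A \<mu> y) $ i\<bar> \<le> ((\<Sum>j\<in>UNIV. \<bar>A $ i $ j\<bar> * 2) + \<bar>\<mu> $ i\<bar> * 2) * ?d"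
        using \<mu>[of i]
        by (simp add: oim_lift_def sum_subtractf sum_distrib_right distrib_right)
    qed
    finally show ?thesis by (simp add: L_def dist_norm sum_distrib_right)
  qed
  moreover have "0 \<le> L" unfolding L_def by (intro sum_nonneg add_nonneg_nonneg) auto
  ultimately show ?thesis by (auto simp: lipschitz_on_def)
qed

text \<open>Averaging the coupling sum with its index-swapped copy gives the Laplacian form of the
  signed graph. Stated for two vectors, it also yields self-adjointness.\<close>

lemma inner_oim_linear:
  assumes "\<And>i j. A $ i $ j = A $ j $ i"
  shows "x \<bullet> oim_linear A \<mu> y =
    - (1 / 2) * (\<Sum>i\<in>UNIV. \<Sum>j\<in>UNIV. A $ i $ j * ((x $ i - x $ j) * (y $ i - y $ j)))
    - 2 * (\<Sum>i\<in>UNIV. \<mu> $ i * (x $ i * y $ i))"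
proof -
  define S where "S = (\<Sum>i\<in>UNIV. \<Sum>j\<in>UNIV. A $ i $ j * (x $ i * (y $ j - y $ i)))"
  have "S = (\<Sum>j\<in>UNIV. \<Sum>i\<in>UNIV. A $ i $ j * (x $ i * (y $ j - y $ i)))"
    unfolding S_def by (rule sum.swap)
  also have "\<dots> = (\<Sum>i\<in>UNIV. \<Sum>j\<in>UNIV. A $ i $ j * (x $ j * (y $ i - y $ j)))"
    using assms by simp
  finally have "2 * S = S + \<dots>" by simp
  also have "\<dots> = - (\<Sum>i\<in>UNIV. \<Sum>j\<in>UNIV. A $ i $ j * ((x $ i - x $ j) * (y $ i - y $ j)))"
    unfolding S_def sum.distrib[symmetric] sum_negf[symmetric]
    by (intro sum.cong refl) (simp add: algebra_simps)
  finally have "S = - (1 / 2) * (\<Sum>i\<in>UNIV. \<Sum>j\<in>UNIV. A $ i $ j * ((x $ i - x $ j) * (y $ i - y $ j)))"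
    by simp
  moreover have "x \<bullet> oim_linear A \<mu> y = S - 2 * (\<Sum>i\<in>UNIV. \<mu> $ i * (x $ i * y $ i))"
    by (simp add: inner_vec_def oim_linear_def S_def right_diff_distrib sum_subtractf sum_distrib_left
        mult.left_commute mult.assoc)
  ultimately show ?thesis by simp
qed

section \<open>Ising ground states without frustration\<close>

lemma signed_adjacency_abs_le:
  assumes "\<sigma> \<in> spins"
  shows "signed_adjacency J \<sigma> $ i $ j \<le> \<bar>J $ i $ j\<bar>"
  using spins_cases[OF assms, of i] spins_cases[OF assms, of j]
  by (auto simp: signed_adjacency_def)

lemma signed_adjacency_abs_eq:
  assumes "\<sigma> \<in> spins"
  shows "\<bar>signed_adjacency J \<sigma> $ i $ j\<bar> = \<bar>J $ i $ j\<bar>"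
  using spins_cases[OF assms, of i] spins_cases[OF assms, of j]
  by (auto simp: signed_adjacency_def)

lemma ising_energy_signed_adjacency:
  "ising_energy J \<sigma> = - (1 / 2) * (\<Sum>i\<in>UNIV. \<Sum>j\<in>UNIV. signed_adjacency J \<sigma> $ i $ j)"
  by (simp add: ising_energy_def signed_adjacency_def)

text \<open>Replacing each signed weight by its absolute value bounds the energy below by
  \<open>E\<close>. Equality means no negative edge, and \<open>\<tau>\<close> attains it.\<close>

lemma ground_state_iff:
  assumes \<tau>: "\<tau> \<in> spins" "\<And>i j. 0 \<le> signed_adjacency J \<tau> $ i $ j" and \<sigma>: "\<sigma> \<in> spins"
  shows "is_arg_min (ising_energy J) (\<lambda>\<rho>. \<rho> \<in> spins) \<sigma> \<longleftrightarrow> (\<forall>i j. 0 \<le> signed_adjacency J \<sigma> $ i $ j)"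
proof
  define E where "E = - (1 / 2) * (\<Sum>i\<in>UNIV. \<Sum>j\<in>UNIV. \<bar>J $ i $ j\<bar>)"
  have eq: "ising_energy J \<rho> = E" if "\<rho> \<in> spins" "\<And>i j. 0 \<le> signed_adjacency J \<rho> $ i $ j" for \<rho>
    using signed_adjacency_abs_eq[OF that(1), of J] that(2)
    by (simp add: E_def ising_energy_signed_adjacency)
  {
    assume "\<forall>i j. 0 \<le> signed_adjacency J \<sigma> $ i $ j"
    then have "ising_energy J \<sigma> = E" using eq \<sigma> by blast
    moreover have "E \<le> ising_energy J \<rho>" if "\<rho> \<in> spins" for \<rho>
      unfolding E_def ising_energy_signed_adjacency
      by (intro mult_left_mono_neg sum_mono signed_adjacency_abs_le that) simp
    ultimately show "is_arg_min (ising_energy J) (\<lambda>\<rho>. \<rho> \<in> spins) \<sigma>"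
      using \<sigma> by (auto simp: is_arg_min_def not_less)
  }
  assume min: "is_arg_min (ising_energy J) (\<lambda>\<rho>. \<rho> \<in> spins) \<sigma>"
  show "\<forall>i j. 0 \<le> signed_adjacency J \<sigma> $ i $ j"
  proof (rule ccontr)
    assume "\<not> ?thesis"
    then obtain i j where ij: "signed_adjacency J \<sigma> $ i $ j < 0" by (auto simp: not_le)
    have "(\<Sum>j\<in>UNIV. signed_adjacency J \<sigma> $ i $ j) < (\<Sum>j\<in>UNIV. \<bar>J $ i $ j\<bar>)"
      by (rule sum_strict_mono_ex1) (use ij signed_adjacency_abs_le[OF \<sigma>] in \<open>auto intro!: exI[of _ j]\<close>)
    then have "(\<Sum>i\<in>UNIV. \<Sum>j\<in>UNIV. signed_adjacency J \<sigma> $ i $ j) < (\<Sum>i\<in>UNIV. \<Sum>j\<in>UNIV. \<bar>J $ i $ j\<bar>)"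
      by (intro sum_strict_mono_ex1) (auto intro!: sum_mono signed_adjacency_abs_le[OF \<sigma>])
    then have "E < ising_energy J \<sigma>" by (simp add: E_def ising_energy_signed_adjacency)
    then show False using min \<tau> eq[of \<tau>] by (auto simp: is_arg_min_def)
  qed
qed

section \<open>Stability and instability of the spin equilibria\<close>

lemma signed_adjacency_symmetric:
  assumes "transpose J = J"
  shows "signed_adjacency J \<sigma> $ i $ j = signed_adjacency J \<sigma> $ j $ i"
proof -
  have "J $ i $ j = J $ j $ i" using assms by (metis transpose_def vec_lambda_beta)
  then show ?thesis by (simp add: signed_adjacency_def)
qed

text \<open>With nonnegative signed weights the Laplacian part only helps, and the smallest
  \<open>\<mu> $ i\<close> gives the decay rate.\<close>

lemma spin_equilibrium_asymptotically_stable: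
  fixes J :: "real ^ 'n::finite ^ 'n"
  assumes "transpose J = J" "\<sigma> \<in> spins" and nonneg: "\<And>i j. 0 \<le> signed_adjacency J \<sigma> $ i $ j"
    and \<mu>: "\<And>i. 0 < \<mu> $ i"
  shows "asymptotically_stable (oim_field J \<mu>) (spin_equilibrium \<sigma>)"
  unfolding spin_equilibrium_eq
proof (rule asymptotically_stable_by_linearization)
  define c where "c = Min (range (($) \<mu>))"
  have c: "c \<le> \<mu> $ i" for i by (simp add: c_def)
  show "0 < c" unfolding c_def using \<mu> by (subst Min_gr_iff) auto
  show "x \<bullet> oim_linear (signed_adjacency J \<sigma>) \<mu> x \<le> - 2 * c * (x \<bullet> x)" for x
  proof -
    have "0 \<le> (\<Sum>i\<in>UNIV. \<Sum>j\<in>UNIV. signed_adjacency J \<sigma> $ i $ j * ((x $ i - x $ j) * (x $ i - x $ j)))"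
      by (intro sum_nonneg mult_nonneg_nonneg[OF nonneg zero_le_square])
    moreover have "c * (x \<bullet> x) \<le> (\<Sum>i\<in>UNIV. \<mu> $ i * (x $ i * x $ i))"
      unfolding inner_vec_def sum_distrib_left
      by (intro sum_mono) (simp add: mult_right_mono c)
    ultimately show ?thesis
      by (subst inner_oim_linear[OF signed_adjacency_symmetric[OF assms(1)]]) simp
  qed
qed (rule oim_field_spin_shift[OF assms(2)] oim_lift_zero oim_lift_has_derivative)+

lemma spin_equilibrium_unstable:
  fixes J :: "real ^ 'n::finite ^ 'n"
  assumes "transpose J = J" and \<sigma>: "\<sigma> \<in> spins" and \<tau>: "\<tau> \<in> spins"
    and nonneg: "\<And>i j. 0 \<le> signed_adjacency J \<tau> $ i $ j"
    and neg: "signed_adjacency J \<sigma> $ k $ l < 0"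
    and \<mu>: "(\<Sum>i\<in>UNIV. \<mu> $ i) < \<bar>J $ k $ l\<bar>"
  shows "unstable (oim_field J \<mu>) (spin_equilibrium \<sigma>)"
proof -
  let ?A = "signed_adjacency J \<sigma>"
  note sym = signed_adjacency_symmetric[OF assms(1)]
  \<comment> \<open>The unstable direction: its sign changes mark the cut between the spins where
    \<open>\<sigma>\<close> and \<open>\<tau>\<close> agree and those where they differ.\<close>
  define s where "s = (\<chi> i. \<sigma> $ i * \<tau> $ i)"
  define g where "g = (\<lambda>i j. \<bar>J $ i $ j\<bar> - ?A $ i $ j)"
  have s2: "s $ i * s $ i = 1" for i
    using spins_cases[OF \<sigma>, of i] spins_cases[OF \<tau>, of i] by (auto simp: s_def)
  \<comment> \<open>The squared difference is \<open>2 - 2 * (s $ i * s $ j)\<close>, and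
    multiplying \<open>?A\<close> by \<open>s $ i * s $ j\<close> turns it into the signed matrix of
    \<open>\<tau>\<close>, which is \<open>\<bar>J\<bar>\<close> entrywise.\<close>
  have cut: "?A $ i $ j * ((s $ i - s $ j) * (s $ i - s $ j)) = - 2 * g i j" for i j
  proof -
    have "(s $ i - s $ j) * (s $ i - s $ j) = 2 - 2 * (s $ i * s $ j)"
      using s2[of i] s2[of j] by (simp add: algebra_simps)
    moreover have "?A $ i $ j * (s $ i * s $ j) = signed_adjacency J \<tau> $ i $ j"
      using spins_cases[OF \<sigma>, of i] spins_cases[OF \<sigma>, of j] by (auto simp: s_def signed_adjacency_def)
    moreover have "signed_adjacency J \<tau> $ i $ j = \<bar>J $ i $ j\<bar>"
      using signed_adjacency_abs_eq[OF \<tau>, of J i j] nonneg[of i j] by simp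
    ultimately show ?thesis by (simp add: g_def algebra_simps)
  qed
  have g: "0 \<le> g i j" for i j
    using signed_adjacency_abs_le[OF \<sigma>, of J i j] by (simp add: g_def)
  \<comment> \<open>The single negative entry already contributes
    \<open>g k l = 2 * \<bar>J $ k $ l\<bar>\<close>, more than the loss of twice the sum of
    \<open>\<mu>\<close>.\<close>
  have "g k l \<le> (\<Sum>j\<in>UNIV. g k j)" by (rule member_le_sum) (auto simp: g)
  also have "\<dots> \<le> (\<Sum>i\<in>UNIV. \<Sum>j\<in>UNIV. g i j)"
    by (rule member_le_sum) (auto simp: g intro!: sum_nonneg)
  finally have "2 * \<bar>J $ k $ l\<bar> \<le> (\<Sum>i\<in>UNIV. \<Sum>j\<in>UNIV. g i j)"
    using signed_adjacency_abs_eq[OF \<sigma>, of J k l] neg by (simp add: g_def)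
  moreover have "s \<bullet> oim_linear ?A \<mu> s = (\<Sum>i\<in>UNIV. \<Sum>j\<in>UNIV. g i j) - 2 * (\<Sum>i\<in>UNIV. \<mu> $ i)"
    by (subst inner_oim_linear[OF sym]) (simp add: cut s2 sum_negf flip: sum_distrib_left)
  ultimately have pos: "0 < s \<bullet> oim_linear ?A \<mu> s" using \<mu> by linarith
  have self_adjoint: "oim_linear ?A \<mu> x \<bullet> y = x \<bullet> oim_linear ?A \<mu> y" for x y
    unfolding inner_commute[of "oim_linear ?A \<mu> x"] inner_oim_linear[OF sym]
    by (simp add: mult.commute mult.left_commute)
  obtain L where "L-lipschitz_on UNIV (oim_lift ?A \<mu>)" using oim_lift_lipschitz by blast
  then show ?thesis
    unfolding spin_equilibrium_eq
    by (intro unstable_by_linearization[OF oim_field_spin_shift[OF \<sigma>] oim_lift_has_derivative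
          oim_lift_zero _ self_adjoint pos])
qed

theorem theorem1:
  fixes J :: "real ^ 'n::finite ^ 'n"
  assumes "transpose J = J"
    and "\<forall>i. J $ i $ i = 0"
    and "frustration_free J"
  shows "(\<forall>\<sigma>. is_arg_min (ising_energy J) (\<lambda>\<tau>. \<tau> \<in> spins) \<sigma> \<longrightarrow>
            (\<forall>\<mu> :: real ^ 'n. (\<forall>i. 0 < \<mu> $ i) \<longrightarrow>
               asymptotically_stable (oim_field J \<mu>) (spin_equilibrium \<sigma>)))
       \<and> (\<exists>\<mu>star>0. \<forall>\<mu> :: real ^ 'n. (\<forall>i. 0 < \<mu> $ i \<and> \<mu> $ i < \<mu>star) \<longrightarrow>
            (\<forall>\<sigma>\<in>spins. \<not> is_arg_min (ising_energy J) (\<lambda>\<tau>. \<tau> \<in> spins) \<sigma> \<longrightarrow>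
               unstable (oim_field J \<mu>) (spin_equilibrium \<sigma>)))"
proof -
  obtain \<tau> where \<tau>: "\<tau> \<in> spins" "\<And>i j. 0 \<le> signed_adjacency J \<tau> $ i $ j"
    using assms(3) unfolding frustrated_def by (auto simp: not_less)
  \<comment> \<open>The element \<open>1\<close> keeps the set nonempty when \<open>J = 0\<close>;
    \<open>w\<close> is then a positive lower bound for all nonzero coupling strengths.\<close>
  define W where "W = insert 1 ((\<lambda>(i, j). \<bar>J $ i $ j\<bar>) ` {(i, j). J $ i $ j \<noteq> 0})"
  define w where "w = Min W"
  have "finite W" by (simp add: W_def)
  have "w > 0" unfolding w_def using \<open>finite W\<close> by (subst Min_gr_iff) (auto simp: W_def)
  have w: "w \<le> \<bar>J $ i $ j\<bar>" if "J $ i $ j \<noteq> 0" for i j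
    unfolding w_def by (rule Min_le[OF \<open>finite W\<close>]) (use that in \<open>auto simp: W_def image_iff\<close>)
  show ?thesis
  \<comment> \<open>Dividing by the number of nodes keeps the sum of all \<open>\<mu> $ i\<close>
    below \<open>w\<close>, as the instability criterion needs.\<close>
  proof (intro conjI allI impI exI[of _ "w / CARD('n)"] ballI)
    fix \<sigma> and \<mu> :: "real ^ 'n"
    assume min: "is_arg_min (ising_energy J) (\<lambda>\<tau>. \<tau> \<in> spins) \<sigma>" and "\<forall>i. 0 < \<mu> $ i"
    moreover have "\<sigma> \<in> spins" using min by (simp add: is_arg_min_def)
    ultimately show "asymptotically_stable (oim_field J \<mu>) (spin_equilibrium \<sigma>)"
      using spin_equilibrium_asymptotically_stable[OF assms(1)] ground_state_iff[OF \<tau>] by blast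
  next
    fix \<mu> :: "real ^ 'n" and \<sigma>
    assume \<mu>: "\<forall>i. 0 < \<mu> $ i \<and> \<mu> $ i < w / CARD('n)" and \<sigma>: "\<sigma> \<in> spins"
      and "\<not> is_arg_min (ising_energy J) (\<lambda>\<tau>. \<tau> \<in> spins) \<sigma>"
    then obtain k l where neg: "signed_adjacency J \<sigma> $ k $ l < 0"
      using ground_state_iff[OF \<tau> \<sigma>] by (auto simp: not_le)
    have "(\<Sum>i\<in>UNIV. \<mu> $ i) < (\<Sum>i\<in>(UNIV :: 'n set). w / CARD('n))"
      by (rule sum_strict_mono) (use \<mu> in auto)
    also have "\<dots> = w" by simp
    also have "\<dots> \<le> \<bar>J $ k $ l\<bar>" by (rule w) (use neg in \<open>auto simp: signed_adjacency_def\<close>)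
    finally show "unstable (oim_field J \<mu>) (spin_equilibrium \<sigma>)"
      by (rule spin_equilibrium_unstable[OF assms(1) \<sigma> \<tau> neg])
  qed (use \<open>w > 0\<close> in simp)
qed

end
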